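(* Let $(X,d)$ be a metric space and let $F:X\to 2^X$ be a set-valued map. Assume that: (1) $F$ is onto, i.e. for every $y\in X$ there is $x\in X$ with $y\in F(x)$; (2) $F$ is continuous with respect to the Hausdorff metric; (3) $F$ has the periodic shadowing property. Then $F^{-1}$ also has the periodic shadowing property.
   Context: Here $\mathbb N=\{0,1,2,\dots\}$ and $2^X$ is the family of nonempty compact subsets of $X$, with the Hausdorff metric $d_H(A,B)=\max\{\sup_{a\in A}d(a,B),\sup_{b\in B}d(b,A)\}$, where $d(x,A)=\inf\{d(x,y): y\in A\}$. Continuity with respect to the Hausdorff metric means continuity of $F:(X,d)\to(2^X,d_H)$. The inverse of $F$ is defined by $F^{-1}(y)=\{x\in X: y\in F(x)\}$ for $y\in X$; since $F$ is onto, its values are nonempty subsets of $X$. The following notions are used for any map $G$ assigning to each point of $X$ a nonempty subset of $X$ (in particular $G=F$ and $G=F^{-1}$). An orbit of $G$ is a sequence $\{x_i\}_{i\in\mathbb N}$ with $x_{i+1}\in G(x_i)$ for all $i$. A $\delta$-pseudo-orbit of $G$ is a sequence $\{x_i\}_{i\in\mathbb N}$ with $d(x_{i+1},G(x_i))<\delta$ for all $i$. A sequence $\{x_i\}_{i\in\mathbb N}$ is periodic if there is an integer $m\ge 1$ with $x_{i+m}=x_i$ for all $i\in\mathbb N$. $G$ has the periodic shadowing property if for every $\varepsilon>0$ there is $\delta>0$ such that for every periodic $\delta$-pseudo-orbit $\{x_i\}_{i\in\mathbb N}$ of $G$ there is a periodic orbit $\{z_i\}_{i\in\mathbb N}$ of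 $G$ (not required to have the same period) with $d(z_i,x_i)<\varepsilon$ for all $i\in\mathbb N$. *)

theory Defs
  imports "HOL-Analysis.Analysis"
begin

text \<open>The metric space is the whole type \<open>'a\<close>; \<open>hyperspace\<close> is the family $2^X$.\<close>

definition hyperspace :: "'a::metric_space set set" where
  "hyperspace = {A. A \<noteq> {} \<and> compact A}"

text \<open>Meaningful on \<open>hyperspace\<close>, where both suprema are taken over nonempty sets and are bounded.\<close>

definition hausdorff_dist :: "'a::metric_space set \<Rightarrow> 'a set \<Rightarrow> real" where
  "hausdorff_dist A B = max (SUP a\<in>A. infdist a B) (SUP b\<in>B. infdist b A)"

definition hausdorff_continuous :: "('a::metric_space \<Rightarrow> 'a set) \<Rightarrow> bool" where
  "hausdorff_continuous F \<longleftrightarrow>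
     (\<forall>x. \<forall>e>0. \<exists>d>0. \<forall>y. dist y x < d \<longrightarrow> hausdorff_dist (F y) (F x) < e)"

definition onto_setvalued :: "('a \<Rightarrow> 'a set) \<Rightarrow> bool" where
  "onto_setvalued F \<longleftrightarrow> (\<forall>y. \<exists>x. y \<in> F x)"

definition inverse_setvalued :: "('a \<Rightarrow> 'a set) \<Rightarrow> 'a \<Rightarrow> 'a set" where
  "inverse_setvalued F y = {x. y \<in> F x}"

definition is_orbit :: "('a \<Rightarrow> 'a set) \<Rightarrow> (nat \<Rightarrow> 'a) \<Rightarrow> bool" where
  "is_orbit G x \<longleftrightarrow> (\<forall>i. x (Suc i) \<in> G (x i))"

text \<open>For maps with nonempty values, since \<open>infdist\<close> to the empty set is \<open>0\<close>.\<close>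

definition is_pseudo_orbit :: "real \<Rightarrow> ('a::metric_space \<Rightarrow> 'a set) \<Rightarrow> (nat \<Rightarrow> 'a) \<Rightarrow> bool" where
  "is_pseudo_orbit \<delta> G x \<longleftrightarrow> (\<forall>i. infdist (x (Suc i)) (G (x i)) < \<delta>)"

definition is_periodic_seq :: "(nat \<Rightarrow> 'a) \<Rightarrow> bool" where
  "is_periodic_seq x \<longleftrightarrow> (\<exists>m\<ge>1. \<forall>i. x (i + m) = x i)"

definition periodic_shadowing :: "('a::metric_space \<Rightarrow> 'a set) \<Rightarrow> bool" where
  "periodic_shadowing G \<longleftrightarrow>
     (\<forall>\<epsilon>>0. \<exists>\<delta>>0. \<forall>x. is_periodic_seq x \<and> is_pseudo_orbit \<delta> G x \<longrightarrow>
        (\<exists>z. is_periodic_seq z \<and> is_orbit G z \<and> (\<forall>i. dist (z i) (x i) < \<epsilon>)))"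

end

theory Submission
  imports Defs
begin

text \<open>
  A periodic \<open>\<delta>\<close>-pseudo-orbit \<open>x\<close> of \<open>F\<^sup>-\<^sup>1\<close> comes with points \<open>y\<^sub>i\<close> such that
  \<open>x\<^sub>i \<in> F y\<^sub>i\<close> and \<open>d (x\<^sub>i\<^sub>+\<^sub>1, y\<^sub>i) < \<delta>\<close>. Hence \<open>d (y\<^sub>i, F y\<^sub>i\<^sub>+\<^sub>1) < \<delta>\<close>: read backwards, \<open>y\<close> is a
  periodic \<open>\<delta>\<close>-pseudo-orbit of \<open>F\<close>. Reversing a periodic orbit of \<open>F\<close> that shadows it gives a
  periodic orbit of \<open>F\<^sup>-\<^sup>1\<close> that shadows \<open>y\<close>, and after a shift by one it shadows \<open>x\<close>.
  A sequence of period \<open>m\<close> is reversed by \<open>i \<mapsto> (m - 1) i\<close>, since \<open>m - 1\<close> is \<open>-1\<close> modulo \<open>m\<close>.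
\<close>

lemma periodic_add_mult:
  fixes x :: "nat \<Rightarrow> 'a"
  assumes "\<And>i. x (i + m) = x i"
  shows "x (i + n * m) = x i"
proof (induction n)
  case (Suc n)
  have "x (i + Suc n * m) = x ((i + n * m) + m)"
    by (simp add: algebra_simps)
  also have "\<dots> = x i"
    using Suc assms by (simp only:)
  finally show ?case .
qed simp

text \<open>Congruence modulo \<open>m\<close>, phrased without subtraction on
  \<open>nat\<close>.\<close>

lemma periodic_eqI:
  fixes x :: "nat \<Rightarrow> 'a"
  assumes "\<And>i. x (i + m) = x i" and "i + s * m = j + t * m"
  shows "x i = x j"
  using periodic_add_mult[of x m, OF assms(1)] assms(2) by metis

lemma periodic_pseudo_orbit_inverse_witness:
  fixes F :: "'a::metric_space \<Rightarrow> 'a set"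
  assumes "onto_setvalued F" and "is_pseudo_orbit \<delta> (inverse_setvalued F) x"
    and period: "\<And>i. x (i + m) = x i"
  obtains y where "\<And>i. x i \<in> F (y i)" and "\<And>i. dist (x (Suc i)) (y i) < \<delta>"
    and "\<And>i. y (i + m) = y i"
proof -
  \<comment> \<open>The choice depends on \<open>i\<close> only through \<open>x i\<close> and
    \<open>x (Suc i)\<close>, so \<open>y\<close> inherits the period of \<open>x\<close>.\<close>
  define y where "y i = (SOME p. x i \<in> F p \<and> dist (x (Suc i)) p < \<delta>)" for i
  have "\<exists>p. x i \<in> F p \<and> dist (x (Suc i)) p < \<delta>" for i
  proof -
    let ?A = "inverse_setvalued F (x i)"
    \<comment> \<open>Over a nonempty set, a strict bound on the infimum is met by some
      element.\<close>
    have "?A \<noteq> {}"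
      using assms(1) by (auto simp: onto_setvalued_def inverse_setvalued_def)
    moreover have "infdist (x (Suc i)) ?A < \<delta>"
      using assms(2) by (simp add: is_pseudo_orbit_def)
    ultimately have "\<exists>p\<in>?A. dist (x (Suc i)) p < \<delta>"
      by (simp add: infdist_notempty cINF_less_iff)
    then show ?thesis
      by (auto simp: inverse_setvalued_def)
  qed
  then have y: "x i \<in> F (y i) \<and> dist (x (Suc i)) (y i) < \<delta>" for i
    unfolding y_def by (rule someI_ex)
  moreover have "y (i + m) = y i" for i
    using period[of i] period[of "Suc i"] by (simp add: y_def)
  ultimately show thesis
    using that by blast
qed

theorem theorem5p4:
  fixes F :: "'a::metric_space \<Rightarrow> 'a set"
  assumes "\<And>x. F x \<in> hyperspace"
    and "onto_setvalued F"
    and "hausdorff_continuous F"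
    and "periodic_shadowing F"
  shows "periodic_shadowing (inverse_setvalued F)"
  unfolding periodic_shadowing_def
proof (intro allI impI)
  fix \<epsilon> :: real
  assume "\<epsilon> > 0"
  then have "\<epsilon> / 2 > 0"
    by simp
  then obtain \<delta>' where "\<delta>' > 0" and shadow:
    "\<And>x. is_periodic_seq x \<Longrightarrow> is_pseudo_orbit \<delta>' F x \<Longrightarrow>
       \<exists>z. is_periodic_seq z \<and> is_orbit F z \<and> (\<forall>i. dist (z i) (x i) < \<epsilon> / 2)"
    using assms(4)[unfolded periodic_shadowing_def, rule_format, of "\<epsilon> / 2"] by blast
  \<comment> \<open>\<open>\<delta>'\<close> makes the reversed \<open>y\<close> admissible for
    shadowing; \<open>\<epsilon> / 2\<close> pays for passing from \<open>y\<close> back to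
    \<open>x\<close>.\<close>
  define \<delta> where "\<delta> = min \<delta>' (\<epsilon> / 2)"
  have "\<exists>w. is_periodic_seq w \<and> is_orbit (inverse_setvalued F) w \<and> (\<forall>i. dist (w i) (x i) < \<epsilon>)"
    if "is_periodic_seq x" and po: "is_pseudo_orbit \<delta> (inverse_setvalued F) x" for x
  proof -
    obtain m where "m \<ge> 1" and "\<And>i. x (i + m) = x i"
      using \<open>is_periodic_seq x\<close> unfolding is_periodic_seq_def by blast
    then obtain p where x: "\<And>i. x (i + Suc p) = x i"
      by (cases m) auto
    obtain y where xF: "\<And>i. x i \<in> F (y i)" and xy: "\<And>i. dist (x (Suc i)) (y i) < \<delta>"
      and y: "\<And>i. y (i + Suc p) = y i"
      using periodic_pseudo_orbit_inverse_witness[where x = x, OF assms(2) po x] by blast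
    define u where "u i = y (p * i)" for i
    have "u (i + Suc p) = u i" for i
      unfolding u_def by (rule periodic_eqI[where x = y, OF y, of _ 0 _ p]) (simp add: algebra_simps)
    then have "is_periodic_seq u"
      unfolding is_periodic_seq_def by (intro exI[of _ "Suc p"]) simp
    moreover have "infdist (u (Suc i)) (F (u i)) < \<delta>'" for i
    proof -
      \<comment> \<open>Periodicity gives \<open>u i = y (p * i + Suc p)\<close>, while
        \<open>u (Suc i)\<close> is \<open>y\<close> one index earlier.\<close>
      have "x (Suc (p * i + p)) \<in> F (u i)"
        using xF[of "p * i + Suc p"] y[of "p * i"] by (simp add: u_def)
      then have "infdist (u (Suc i)) (F (u i)) \<le> dist (u (Suc i)) (x (Suc (p * i + p)))"
        by (rule infdist_le)
      also have "\<dots> < \<delta>"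
        using xy[of "p * i + p"] by (simp add: u_def dist_commute add.commute)
      finally show ?thesis
        by (simp add: \<delta>_def)
    qed
    then have "is_pseudo_orbit \<delta>' F u"
      by (simp add: is_pseudo_orbit_def)
    ultimately obtain z where "is_periodic_seq z" and zF: "\<And>i. z (Suc i) \<in> F (z i)"
      and zu: "\<And>i. dist (z i) (u i) < \<epsilon> / 2"
      using shadow[of u] by (auto simp: is_orbit_def)
    then obtain k where "k \<ge> 1" and zk: "\<And>i. z (i + k) = z i"
      unfolding is_periodic_seq_def by blast
    \<comment> \<open>The period \<open>k\<close> of \<open>z\<close> may differ from
      \<open>Suc p\<close>; \<open>n\<close> is -1 modulo both, so one factor reverses
      \<open>z\<close> and \<open>y\<close> alike.\<close>
    define n where "n = k * Suc p - 1"
    have n: "Suc n = k * Suc p"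
      using \<open>k \<ge> 1\<close> by (simp add: n_def)
    have z: "z (i + Suc n) = z i" for i
      using periodic_add_mult[of z k i "Suc p", OF zk] n by (simp add: mult.commute)
    \<comment> \<open>Modulo the period, \<open>w i\<close> is \<open>z\<close> at 1 - i; the
      \<open>Suc\<close> is the shift that matches \<open>x\<close> instead of
      \<open>y\<close>.\<close>
    define w where "w i = z (Suc (n * i))" for i
    have "w (i + Suc n) = w i" for i
      unfolding w_def by (rule periodic_eqI[where x = z, OF z, of _ 0 _ n]) (simp add: algebra_simps)
    then have "is_periodic_seq w"
      unfolding is_periodic_seq_def by (intro exI[of _ "Suc n"]) simp
    moreover have "w i \<in> F (w (Suc i))" for i
      using zF[of "n * i"] z[of "n * i"] by (simp add: w_def add.commute)
    then have "is_orbit (inverse_setvalued F) w"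
      by (simp add: is_orbit_def inverse_setvalued_def)
    moreover have "dist (w i) (x i) < \<epsilon>" for i
    proof -
      \<comment> \<open>Modulo \<open>Suc p\<close>, the index of \<open>y\<close> is -(1 - i) = i -
        1, that is, \<open>i + p\<close>.\<close>
      have "p * Suc (n * i) + i * Suc p = (i + p) + p * i * Suc n"
        by (simp add: algebra_simps)
      then have "u (Suc (n * i)) = y (i + p)"
        unfolding u_def by (intro periodic_eqI[where x = y, OF y, of _ i _ "p * i * k"]) (simp only: n mult.assoc)
      moreover have "dist (x i) (y (i + p)) < \<epsilon> / 2"
        using xy[of "i + p"] x[of i] by (simp add: \<delta>_def)
      ultimately show ?thesis
        using zu[of "Suc (n * i)"] unfolding w_def
        by (metis dist_commute dist_triangle_half_r)
    qed
    ultimately show ?thesis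
      by blast
  qed
  moreover have "\<delta> > 0"
    using \<open>\<epsilon> > 0\<close> \<open>\<delta>' > 0\<close> by (simp add: \<delta>_def)
  ultimately show "\<exists>\<delta>>0. \<forall>x. is_periodic_seq x \<and> is_pseudo_orbit \<delta> (inverse_setvalued F) x \<longrightarrow>
      (\<exists>z. is_periodic_seq z \<and> is_orbit (inverse_setvalued F) z \<and> (\<forall>i. dist (z i) (x i) < \<epsilon>))"
    by blast
qed

end
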